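(* Let $A\in\{0,1\}^{n\times d}$, $k$ a positive integer, $\langle\cdot,\cdot\rangle:\{0,1\}^k\times\{0,1\}^k\to\mathbb{R}$, and $\varepsilon\in(0,1)$. Let $V\in\{0,1\}^{k\times d}$ be arbitrary, let $t=2^{4k+14}/\varepsilon^2$, let $\alpha=(\alpha_y)_{y\in\{0,1\}^k}$ be a sequence of $\tfrac{\varepsilon}{6}$-approximate cluster sizes with respect to $V$ and $t$, and let $\widetilde C$ be drawn from the distribution $\mathcal{D}_{V,t}$. Then \[\mathbb{E}_{\widetilde C}\big[\|A-\widetilde U(\widetilde C,\alpha)\cdot V\|_0\big]\le(1+\varepsilon)\,\mathrm{OPT}_k^V.\]
   Context: Products: for $U\in\{0,1\}^{n\times k}$, $U\cdot V$ is the $n\times d$ matrix with entries $\langle U_{i,:},V_{:,j}\rangle$; $\|M\|_0$ is the number of nonzero entries. $\mathrm{OPT}_k^V:=\min_{U\in\{0,1\}^{n\times k}}\|A-U\cdot V\|_0$. For $y\in\{0,1\}^k$ let $C^V_y:=\{j\in[d]: V_{:,j}=y\}$. Distribution $\mathcal{D}_{V,t}$ over families $\widetilde C=(\widetilde C_y)_{y\in\{0,1\}^k}$: independently for each $y$, if $|C^V_y|<t$ then $\widetilde C_y=C^V_y$, otherwise $\widetilde C_y$ is the multiset of $t$ elements sampled uniformly from $C^V_y$ with replacement. A sequence $\alpha$ is a sequence of $\delta$-approximate cluster sizes if $\alpha_y=|C^V_y|$ whenever $|C^V_y|<t$ and $|C^V_y|\le\alpha_y\le(1+\delta)|C^V_y|$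 otherwise. For row $i$ and $x\in\{0,1\}^k$, the estimated cost is $\widetilde E_{i,x}:=\sum_{y\in\{0,1\}^k}\frac{\alpha_y}{|\widetilde C_y|}\,\big|\{j\in\widetilde C_y: A_{i,j}\neq\langle x,y\rangle\}\big|$ (counted with multiplicity; the summand is $0$ when $C^V_y=\emptyset$). $\widetilde U(\widetilde C,\alpha)\in\{0,1\}^{n\times k}$ is any matrix whose $i$-th row is a minimizer of $\widetilde E_{i,x}$ over $x\in\{0,1\}^k$ (ties broken by any fixed rule). *)

theory Defs
  imports "HOL-Probability.Probability" "Jordan_Normal_Form.Matrix"
begin

hide_type (open) Finite_Cartesian_Product.vec
hide_const (open) Finite_Cartesian_Product.vec Finite_Cartesian_Product.mat
  Finite_Cartesian_Product.row Finite_Cartesian_Product.vec_nth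
no_notation Finite_Cartesian_Product.vec_nth (infixl "$" 90)

definition binary_vecs :: "nat \<Rightarrow> real vec set" where
  "binary_vecs k = {x \<in> carrier_vec k. \<forall>i<k. x $ i \<in> {0, 1}}"

definition binary_mats :: "nat \<Rightarrow> nat \<Rightarrow> real mat set" where
  "binary_mats n m = {M \<in> carrier_mat n m. \<forall>i<n. \<forall>j<m. M $$ (i, j) \<in> {0, 1}}"

text \<open>The function \<open>ip\<close> plays the role of the arbitrary map from pairs of binary vectors to the
  reals. It is total on \<open>real vec\<close>, but it is only ever applied to binary vectors.\<close>

definition gen_prod :: "(real vec \<Rightarrow> real vec \<Rightarrow> real) \<Rightarrow> real mat \<Rightarrow> real mat \<Rightarrow> real mat" where
  "gen_prod ip U V = mat (dim_row U) (dim_col V) (\<lambda>(i, j). ip (row U i) (col V j))"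

definition norm0 :: "real mat \<Rightarrow> nat" where
  "norm0 M = card {(i, j). i < dim_row M \<and> j < dim_col M \<and> M $$ (i, j) \<noteq> 0}"

definition opt_cost :: "(real vec \<Rightarrow> real vec \<Rightarrow> real) \<Rightarrow> real mat \<Rightarrow> real mat \<Rightarrow> nat" where
  "opt_cost ip A V = Min ((\<lambda>U. norm0 (A - gen_prod ip U V)) ` binary_mats (dim_row A) (dim_row V))"

definition cluster :: "real mat \<Rightarrow> real vec \<Rightarrow> nat set" where
  "cluster V y = {j. j < dim_col V \<and> col V j = y}"

text \<open>The threshold \<open>t\<close> is real and need not be an integer; the number of samples drawn is \<open>t\<close>
  rounded up. The comparison of a cardinality with \<open>t\<close> is unaffected by this rounding. For
  \<open>t > 0\<close>, the set passed to \<open>pmf_of_set\<close> is nonempty.\<close>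

definition sample_cluster :: "real \<Rightarrow> nat set \<Rightarrow> nat multiset pmf" where
  "sample_cluster t C =
     (if real (card C) < t then return_pmf (mset_set C)
      else map_pmf mset (replicate_pmf (nat \<lceil>t\<rceil>) (pmf_of_set C)))"

definition cluster_samples :: "real mat \<Rightarrow> real \<Rightarrow> (real vec \<Rightarrow> nat multiset) pmf" where
  "cluster_samples V t =
     Pi_pmf (binary_vecs (dim_row V)) {#} (\<lambda>y. sample_cluster t (cluster V y))"

definition approx_cluster_sizes :: "real \<Rightarrow> real mat \<Rightarrow> real \<Rightarrow> (real vec \<Rightarrow> real) \<Rightarrow> bool" where
  "approx_cluster_sizes \<delta> V t \<alpha> \<longleftrightarrow>
     (\<forall>y \<in> binary_vecs (dim_row V).
        if real (card (cluster V y)) < t then \<alpha> y = real (card (cluster V y))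
        else real (card (cluster V y)) \<le> \<alpha> y \<and> \<alpha> y \<le> (1 + \<delta>) * real (card (cluster V y)))"

text \<open>If \<open>C y\<close> is empty, its summand is \<open>0\<close>.\<close>

definition est_cost ::
  "(real vec \<Rightarrow> real vec \<Rightarrow> real) \<Rightarrow> real mat \<Rightarrow> nat \<Rightarrow> (real vec \<Rightarrow> nat multiset) \<Rightarrow>
    (real vec \<Rightarrow> real) \<Rightarrow> nat \<Rightarrow> real vec \<Rightarrow> real" where
  "est_cost ip A k C \<alpha> i x =
     (\<Sum>y\<in>binary_vecs k. \<alpha> y / real (size (C y)) * real (size {#j \<in># C y. A $$ (i, j) \<noteq> ip x y#}))"

definition is_est_minimizer ::
  "(real vec \<Rightarrow> real vec \<Rightarrow> real) \<Rightarrow> real mat \<Rightarrow> nat \<Rightarrow> (real vec \<Rightarrow> nat multiset) \<Rightarrow>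
    (real vec \<Rightarrow> real) \<Rightarrow> real mat \<Rightarrow> bool" where
  "is_est_minimizer ip A k C \<alpha> U \<longleftrightarrow>
     U \<in> binary_mats (dim_row A) k \<and>
     (\<forall>i<dim_row A. is_arg_min (est_cost ip A k C \<alpha> i) (\<lambda>x. x \<in> binary_vecs k) (row U i))"

end

theory Submission imports Defs begin

text \<open>Fix a row and let \<open>x0\<close> be the corresponding row of an optimal \<open>U\<close>. For a competitor \<open>x\<close>, the
  estimated cost difference between \<open>x\<close> and \<open>x0\<close> is a sum of independent contributions of the
  clusters, whose mean is at least \<open>cost x - (1 + \<epsilon>/6) cost x0\<close>. Only clusters with
  \<open>ip x y \<noteq> ip x0 y\<close> contribute variance; on these every column is an error of \<open>x\<close> or of \<open>x0\<close>,
  which bounds the total variance by \<open>(16/t) cost x0 (cost x + cost x0)\<close>. The factor \<open>cost x0\<close> is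
  essential: it makes the expected loss from selecting \<open>x\<close> proportional to \<open>cost x0\<close> even when
  \<open>cost x\<close> is much larger. Chebyshev's inequality and a union bound over the at most \<open>2^k\<close>
  competitors whose excess cost exceeds \<open>(\<epsilon>/3) cost x0\<close> then bound each row.\<close>

section \<open>Second moments of sums of independent variables\<close>

lemma expectation_bind_pmf_finite:
  fixes h :: "'b \<Rightarrow> real"
  assumes "finite (set_pmf p)" "\<And>x. x \<in> set_pmf p \<Longrightarrow> finite (set_pmf (f x))"
  shows "measure_pmf.expectation (bind_pmf p f) h =
    measure_pmf.expectation p (\<lambda>x. measure_pmf.expectation (f x) h)"
  using assms by (subst pmf_expectation_bind[of "set_pmf p"]) (auto simp: integral_measure_pmf[of "set_pmf p"])

text \<open>The cross term vanishes because \<open>g\<close> is centered. This is the induction step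
  for adding one independent draw.\<close>

lemma expectation_add_square:
  fixes f :: "'a \<Rightarrow> real" and g :: "'b \<Rightarrow> real"
  assumes p: "finite (set_pmf p)" and q: "finite (set_pmf q)"
    and g0: "measure_pmf.expectation q g = 0"
  shows "measure_pmf.expectation p (\<lambda>x. measure_pmf.expectation q (\<lambda>y. (f x + g y)\<^sup>2)) =
    measure_pmf.expectation p (\<lambda>x. (f x)\<^sup>2) + measure_pmf.expectation q (\<lambda>y. (g y)\<^sup>2)"
proof -
  note [simp] = integrable_measure_pmf_finite[OF p] integrable_measure_pmf_finite[OF q]
  have "measure_pmf.expectation q (\<lambda>y. (f x + g y)\<^sup>2) =
      (f x)\<^sup>2 + measure_pmf.expectation q (\<lambda>y. (g y)\<^sup>2)" for x
    by (simp add: power2_sum g0 mult.assoc)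
  then show ?thesis by simp
qed

lemma finite_set_replicate_pmf: "finite (set_pmf p) \<Longrightarrow> finite (set_pmf (replicate_pmf n p))"
  by (induction n) simp_all

text \<open>Independence makes the second moment linear in \<open>n\<close>. Both moments share one
  induction because the second needs the tail sum to be centered.\<close>

lemma replicate_pmf_centered_moments:
  fixes h :: "'a \<Rightarrow> real"
  assumes p: "finite (set_pmf p)" and h0: "measure_pmf.expectation p h = 0"
  shows "measure_pmf.expectation (replicate_pmf n p) (\<lambda>xs. sum_list (map h xs)) = 0 \<and>
    measure_pmf.expectation (replicate_pmf n p) (\<lambda>xs. (sum_list (map h xs))\<^sup>2) =
      real n * measure_pmf.expectation p (\<lambda>x. (h x)\<^sup>2)"
proof (induction n)
  case (Suc n)
  note q = finite_set_replicate_pmf[OF p, of n]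
  note [simp] = integrable_measure_pmf_finite[OF p] integrable_measure_pmf_finite[OF q]
  show ?case
    using Suc by (simp add: expectation_bind_pmf_finite p q expectation_add_square h0 algebra_simps)
qed simp

lemma finite_set_Pi_pmf:
  assumes "finite Y" "\<And>y. y \<in> Y \<Longrightarrow> finite (set_pmf (p y))"
  shows "finite (set_pmf (Pi_pmf Y d p))"
  using assms by (auto simp: set_Pi_pmf intro!: finite_PiE_dflt)

lemma Pi_pmf_centered_moments:
  fixes h :: "'a \<Rightarrow> 'b \<Rightarrow> real"
  assumes "finite Y" "\<And>y. y \<in> Y \<Longrightarrow> finite (set_pmf (p y))"
    and "\<And>y. y \<in> Y \<Longrightarrow> measure_pmf.expectation (p y) (h y) = 0"
  shows "measure_pmf.expectation (Pi_pmf Y d p) (\<lambda>f. \<Sum>y\<in>Y. h y (f y)) = 0 \<and>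
    measure_pmf.expectation (Pi_pmf Y d p) (\<lambda>f. (\<Sum>y\<in>Y. h y (f y))\<^sup>2) =
      (\<Sum>y\<in>Y. measure_pmf.expectation (p y) (\<lambda>x. (h y x)\<^sup>2))"
  using assms
proof (induction Y rule: finite_induct)
  case (insert z Y)
  have p: "finite (set_pmf (p z))" using insert by simp
  have q: "finite (set_pmf (Pi_pmf Y d p))" using insert by (intro finite_set_Pi_pmf) auto
  note [simp] = integrable_measure_pmf_finite[OF p] integrable_measure_pmf_finite[OF q]
  \<comment> \<open>\<open>Pi_pmf_insert'\<close> produces an update at \<open>z\<close>, which lies
    outside \<open>Y\<close>.\<close>
  have [simp]: "(\<Sum>y\<in>Y. h y (if y = z then a else f y)) = (\<Sum>y\<in>Y. h y (f y))" for a f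
    using insert(2) by (intro sum.cong) auto
  have z: "measure_pmf.expectation (p z) (h z) = 0" using insert by simp
  have IH: "measure_pmf.expectation (Pi_pmf Y d p) (\<lambda>f. \<Sum>y\<in>Y. h y (f y)) = 0"
    "measure_pmf.expectation (Pi_pmf Y d p) (\<lambda>f. (\<Sum>y\<in>Y. h y (f y))\<^sup>2) =
      (\<Sum>y\<in>Y. measure_pmf.expectation (p y) (\<lambda>x. (h y x)\<^sup>2))"
    using insert by auto
  show ?case
    using insert(1,2)
    by (simp add: Pi_pmf_insert' expectation_bind_pmf_finite p q expectation_add_square z IH
        del: Bochner_Integration.integral_sum)
qed simp

text \<open>The two sides differ by \<open>(\<mu> - a)\<^sup>2\<close>, so a variance may be bounded
  by centering at any convenient \<open>a\<close>.\<close>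

lemma centered_square_le_pmf:
  fixes Z :: "'a \<Rightarrow> real"
  assumes p: "finite (set_pmf p)"
  shows "measure_pmf.expectation p (\<lambda>x. (Z x - measure_pmf.expectation p Z)\<^sup>2)
    \<le> measure_pmf.expectation p (\<lambda>x. (Z x - a)\<^sup>2)"
proof -
  note [simp] = integrable_measure_pmf_finite[OF p]
  define \<mu> where "\<mu> = measure_pmf.expectation p Z"
  have "measure_pmf.expectation p (\<lambda>x. (Z x - a)\<^sup>2) - measure_pmf.expectation p (\<lambda>x. (Z x - \<mu>)\<^sup>2)
    = (\<mu> - a)\<^sup>2"
    by (simp add: power2_diff \<mu>_def[symmetric] algebra_simps power2_eq_square)
  then show ?thesis unfolding \<mu>_def[symmetric] by (smt (verit) zero_le_power2)
qed

section \<open>Sampling error of a single cluster\<close>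

lemma finite_set_sample_cluster:
  assumes "finite C" "t > 0"
  shows "finite (set_pmf (sample_cluster t C))"
proof (cases "real (card C) < t")
  case False
  then have "C \<noteq> {}" using assms by auto
  with assms have "finite (set_pmf (pmf_of_set C))" by simp
  then show ?thesis using False
    by (auto simp: sample_cluster_def intro!: finite_set_replicate_pmf)
qed (simp add: sample_cluster_def)

text \<open>Deviation of a rescaled sample sum from its mean, with \<open>c\<close> standing for the
  estimated cluster size. If \<open>C\<close> and \<open>M\<close> are empty, division by zero makes
  it \<open>0\<close>.\<close>

definition scaled_error :: "real \<Rightarrow> nat set \<Rightarrow> (nat \<Rightarrow> real) \<Rightarrow> nat multiset \<Rightarrow> real" where
  "scaled_error c C Z M = c / real (size M) * (\<Sum>j\<in>#M. Z j) - c / real (card C) * (\<Sum>j\<in>C. Z j)"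

text \<open>A small cluster is kept whole and has no error; for a large one, averaging at least
  \<open>t\<close> independent draws divides the variance by at least \<open>t\<close>. The free
  center \<open>a\<close> is chosen later to tie the bound to the cost of \<open>x0\<close>.\<close>

lemma scaled_error_moments:
  assumes C: "finite C" and t: "t > 0"
  shows "measure_pmf.expectation (sample_cluster t C) (scaled_error c C Z) = 0"
    and "measure_pmf.expectation (sample_cluster t C) (\<lambda>M. (scaled_error c C Z M)\<^sup>2)
      \<le> c\<^sup>2 / t * ((\<Sum>j\<in>C. (Z j - a)\<^sup>2) / real (card C))"
proof -
  have "measure_pmf.expectation (sample_cluster t C) (scaled_error c C Z) = 0 \<and>
    measure_pmf.expectation (sample_cluster t C) (\<lambda>M. (scaled_error c C Z M)\<^sup>2)
      \<le> c\<^sup>2 / t * ((\<Sum>j\<in>C. (Z j - a)\<^sup>2) / real (card C))"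
  proof (cases "real (card C) < t")
    case True
    have "scaled_error c C Z (mset_set C) = 0"
      unfolding scaled_error_def sum_unfold_sum_mset size_mset_set by (rule diff_self)
    then show ?thesis using t True by (simp add: sample_cluster_def sum_nonneg)
  next
    case False
    define T where "T = nat \<lceil>t\<rceil>"
    have T: "real T \<ge> t" "T > 0" using t by (auto simp: T_def) 
    have ne: "C \<noteq> {}" using False t by auto
    define p where "p = pmf_of_set C"
    have p: "finite (set_pmf p)" using C ne by (simp add: p_def)
    note [simp] = integrable_measure_pmf_finite[OF p]
    define \<mu> where "\<mu> = measure_pmf.expectation p Z"
    have \<mu>: "\<mu> = (\<Sum>j\<in>C. Z j) / real (card C)"
      using C ne by (simp add: \<mu>_def p_def integral_pmf_of_set)
    define q where "q = replicate_pmf T p"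
    have q: "finite (set_pmf q)" unfolding q_def by (rule finite_set_replicate_pmf[OF p])
    have sc: "sample_cluster t C = map_pmf mset q"
      using False by (simp add: sample_cluster_def T_def p_def q_def)
    have shift: "sum_list (map (\<lambda>j. Z j - \<mu>) xs) = sum_list (map Z xs) - real (length xs) * \<mu>" for xs
      by (induction xs) (auto simp: algebra_simps)
    \<comment> \<open>All lists in the support have length \<open>T\<close>, so the normalisation by
      sample size is constant there and the error is a centered sum.\<close>
    have eq: "scaled_error c C Z (mset xs) = c / real T * sum_list (map (\<lambda>j. Z j - \<mu>) xs)"
      if "xs \<in> set_pmf q" for xs
    proof -
      have "length xs = T" using that by (auto simp: q_def set_replicate_pmf)
      moreover have "(\<Sum>j\<in>#mset xs. Z j) = sum_list (map Z xs)"
        by (metis mset_map sum_mset_sum_list)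
      moreover have "c / real (card C) * (\<Sum>j\<in>C. Z j) = c * \<mu>" by (simp add: \<mu>)
      ultimately show ?thesis using T(2)
        unfolding scaled_error_def shift by (simp add: right_diff_distrib)
    qed
    have "measure_pmf.expectation p (\<lambda>j. Z j - \<mu>) = 0" by (simp add: \<mu>_def)
    note mom = replicate_pmf_centered_moments[OF p this, of T, folded q_def]
    have "measure_pmf.expectation (sample_cluster t C) (scaled_error c C Z) =
       measure_pmf.expectation q (\<lambda>xs. c / real T * sum_list (map (\<lambda>j. Z j - \<mu>) xs))"
      unfolding sc integral_map_pmf using eq
      by (intro integral_cong_AE) (auto simp: AE_measure_pmf_iff)
    also have "\<dots> = 0" using mom by simp
    finally have 1: "measure_pmf.expectation (sample_cluster t C) (scaled_error c C Z) = 0" .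
    have "measure_pmf.expectation (sample_cluster t C) (\<lambda>M. (scaled_error c C Z M)\<^sup>2) =
       measure_pmf.expectation q (\<lambda>xs. (c / real T)\<^sup>2 * (sum_list (map (\<lambda>j. Z j - \<mu>) xs))\<^sup>2)"
      unfolding sc integral_map_pmf using eq
      by (intro integral_cong_AE) (auto simp: AE_measure_pmf_iff power_mult_distrib power_divide)
    also have "\<dots> = c\<^sup>2 / real T * measure_pmf.expectation p (\<lambda>j. (Z j - \<mu>)\<^sup>2)"
      using mom T by (simp add: power2_eq_square)
    also have "\<dots> \<le> c\<^sup>2 / t * measure_pmf.expectation p (\<lambda>j. (Z j - a)\<^sup>2)"
      using T t centered_square_le_pmf[OF p, of Z a]
      by (intro mult_mono) (auto simp: \<mu>_def intro!: divide_left_mono Bochner_Integration.integral_nonneg)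
    also have "\<dots> = c\<^sup>2 / t * ((\<Sum>j\<in>C. (Z j - a)\<^sup>2) / real (card C))"
      using C ne by (simp add: p_def integral_pmf_of_set)
    finally show ?thesis using 1 by simp
  qed
  then show "measure_pmf.expectation (sample_cluster t C) (scaled_error c C Z) = 0"
    "measure_pmf.expectation (sample_cluster t C) (\<lambda>M. (scaled_error c C Z M)\<^sup>2)
      \<le> c\<^sup>2 / t * ((\<Sum>j\<in>C. (Z j - a)\<^sup>2) / real (card C))" by auto
qed

section \<open>Selection by noisy estimates\<close>

text \<open>A bad candidate with excess \<open>\<Delta>\<close> contributes \<open>\<Delta>\<close>
  times a selection probability of order variance over \<open>\<Delta>\<^sup>2\<close>. For bad
  candidates the variance bound is linear in \<open>\<Delta>\<close>, so \<open>\<Delta>\<close>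
  cancels and a multiple of \<open>cost x0\<close> remains.\<close>

lemma expectation_cost_minimizer_le:
  fixes cost m :: "'x \<Rightarrow> real" and est :: "'c \<Rightarrow> 'x \<Rightarrow> real"
  assumes P: "finite (set_pmf P)" and X: "finite X" 
    and sel: "\<And>C. sel C \<in> X" "\<And>C. est C (sel C) \<le> est C x0"
    and \<epsilon>: "0 < \<epsilon>" and c0: "0 \<le> cost x0" and v: "0 \<le> v"
    and gap: "\<And>x. x \<in> X \<Longrightarrow> cost x - (1 + \<epsilon> / 6) * cost x0 \<le> m x"
    and var: "\<And>x. x \<in> X \<Longrightarrow> measure_pmf.expectation P (\<lambda>C. (est C x - est C x0 - m x)\<^sup>2)
      \<le> v * cost x0 * (cost x + cost x0)"
  shows "measure_pmf.expectation P (\<lambda>C. cost (sel C))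
    \<le> (1 + \<epsilon> / 3 + real (card X) * (4 * v * (1 + 6 / \<epsilon>))) * cost x0"
proof -
  note [simp] = integrable_measure_pmf_finite[OF P]
  \<comment> \<open>The threshold \<open>\<epsilon> / 3\<close> is twice the slack in
    \<open>gap\<close>, so on \<open>B\<close> the slack consumes less than half of the
    excess.\<close>
  define B where "B = {x \<in> X. (1 + \<epsilon> / 3) * cost x0 < cost x}"
  define D where "D x C = est C x - est C x0 - m x" for x C
  have finB: "finite B" using X by (simp add: B_def)
  have Bpos: "cost x - cost x0 > 0" "\<epsilon> / 3 * cost x0 < cost x - cost x0" if "x \<in> B" for x
  proof -
    show *: "\<epsilon> / 3 * cost x0 < cost x - cost x0" using that by (simp add: B_def algebra_simps)
    have "0 \<le> \<epsilon> / 3 * cost x0" using \<epsilon> c0 by simp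
    with * show "cost x - cost x0 > 0" by linarith
  qed
  \<comment> \<open>Pointwise form of Chebyshev's inequality: \<open>x\<close> can be selected only if \<open>D x\<close> deviates by half the
    excess cost.\<close>
  have pw: "cost (sel C) \<le> (1 + \<epsilon> / 3) * cost x0 + (\<Sum>x\<in>B. 4 / (cost x - cost x0) * (D x C)\<^sup>2)" for C
  proof (cases "sel C \<in> B")
    case False
    then have "cost (sel C) \<le> (1 + \<epsilon> / 3) * cost x0" using sel by (auto simp: B_def)
    moreover have "0 \<le> (\<Sum>x\<in>B. 4 / (cost x - cost x0) * (D x C)\<^sup>2)"
      using Bpos by (intro sum_nonneg mult_nonneg_nonneg) (auto simp: less_imp_le)
    ultimately show ?thesis by linarith
  next
    case True
    define \<Delta> where "\<Delta> = cost (sel C) - cost x0"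
    have \<Delta>: "\<Delta> > 0" "\<epsilon> / 3 * cost x0 < \<Delta>" using Bpos[OF True] by (auto simp: \<Delta>_def)
    have "m (sel C) \<ge> \<Delta> - \<epsilon> / 6 * cost x0" using gap[OF sel(1)[of C]] by (simp add: \<Delta>_def algebra_simps)
    \<comment> \<open>The estimated difference of the selected candidate is at most
      \<open>0\<close>, although its center \<open>m (sel C)\<close> is at least
      \<open>\<Delta> / 2\<close>.\<close>
    then have "- D (sel C) C \<ge> \<Delta> / 2" using sel(2)[of C] \<Delta>(2) by (simp add: D_def)
    then have "(\<Delta> / 2)\<^sup>2 \<le> (- D (sel C) C)\<^sup>2" using \<Delta> by (intro power_mono) auto
    then have "\<Delta> \<le> 4 / \<Delta> * (D (sel C) C)\<^sup>2" using \<Delta>(1)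
      by (simp add: field_simps power2_eq_square)
    also have "\<dots> \<le> (\<Sum>x\<in>B. 4 / (cost x - cost x0) * (D x C)\<^sup>2)"
      unfolding \<Delta>_def using Bpos True finB
      by (intro member_le_sum[where f="\<lambda>x. 4 / (cost x - cost x0) * (D x C)\<^sup>2"] mult_nonneg_nonneg)
         (auto simp: less_imp_le)
    finally have "cost (sel C) \<le> cost x0 + (\<Sum>x\<in>B. 4 / (cost x - cost x0) * (D x C)\<^sup>2)"
      by (simp add: \<Delta>_def)
    moreover have "0 \<le> \<epsilon> / 3 * cost x0" using \<epsilon> c0 by simp
    ultimately show ?thesis by (simp add: algebra_simps)
  qed
  have "measure_pmf.expectation P (\<lambda>C. cost (sel C)) \<le>
    measure_pmf.expectation P (\<lambda>C. (1 + \<epsilon> / 3) * cost x0 + (\<Sum>x\<in>B. 4 / (cost x - cost x0) * (D x C)\<^sup>2))"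
    by (intro integral_mono pw) auto
  also have "\<dots> = (1 + \<epsilon> / 3) * cost x0 +
    (\<Sum>x\<in>B. 4 / (cost x - cost x0) * measure_pmf.expectation P (\<lambda>C. (D x C)\<^sup>2))"
    by simp
  also have "(\<Sum>x\<in>B. 4 / (cost x - cost x0) * measure_pmf.expectation P (\<lambda>C. (D x C)\<^sup>2))
    \<le> (\<Sum>x\<in>B. 4 * v * (1 + 6 / \<epsilon>) * cost x0)"
  proof (rule sum_mono)
    fix x assume x: "x \<in> B"
    define \<Delta> where "\<Delta> = cost x - cost x0"
    have \<Delta>: "\<Delta> > 0" "\<epsilon> / 3 * cost x0 < \<Delta>" using Bpos[OF x] by (auto simp: \<Delta>_def)
    have "measure_pmf.expectation P (\<lambda>C. (D x C)\<^sup>2) \<le> v * cost x0 * (\<Delta> + 2 * cost x0)"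
      using var[of x] x by (simp add: B_def D_def \<Delta>_def add.commute)
    \<comment> \<open>Membership in \<open>B\<close> gives
      \<open>cost x0 < 3 * \<Delta> / \<epsilon>\<close>.\<close>
    also have "\<dots> \<le> v * cost x0 * (\<Delta> * (1 + 6 / \<epsilon>))"
    proof (intro mult_left_mono)
      show "\<Delta> + 2 * cost x0 \<le> \<Delta> * (1 + 6 / \<epsilon>)" using \<Delta> \<epsilon> by (simp add: field_simps)
    qed (use v c0 in auto)
    finally have "4 / \<Delta> * measure_pmf.expectation P (\<lambda>C. (D x C)\<^sup>2)
        \<le> 4 / \<Delta> * (v * cost x0 * (\<Delta> * (1 + 6 / \<epsilon>)))"
      using \<Delta> by (intro mult_left_mono) auto
    also have "\<dots> = 4 * v * (1 + 6 / \<epsilon>) * cost x0" using \<Delta>(1) by simp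
    finally show "4 / (cost x - cost x0) * measure_pmf.expectation P (\<lambda>C. (D x C)\<^sup>2)
      \<le> 4 * v * (1 + 6 / \<epsilon>) * cost x0" by (simp add: \<Delta>_def)
  qed
  also have "\<dots> = real (card B) * (4 * v * (1 + 6 / \<epsilon>) * cost x0)" by simp
  also have "\<dots> \<le> real (card X) * (4 * v * (1 + 6 / \<epsilon>) * cost x0)"
    using X v \<epsilon> c0 by (intro mult_right_mono) (auto simp: B_def intro!: card_mono)
  finally show ?thesis by (simp add: algebra_simps)
qed

section \<open>Binary vectors and costs by row and cluster\<close>

lemma size_filter_mset_eq_sum:
  "real (size {#j \<in># M. P j#}) = (\<Sum>j\<in>#M. of_bool (P j))"
  by (induction M) auto

lemma sum_mset_diff_real:
  fixes f g :: "'a \<Rightarrow> real"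
  shows "(\<Sum>j\<in>#M. f j - g j) = (\<Sum>j\<in>#M. f j) - (\<Sum>j\<in>#M. g j)"
  by (induction M) auto

lemma finite_binary_vecs: "finite (binary_vecs k)"
  and card_binary_vecs_le: "card (binary_vecs k) \<le> 2 ^ k"
proof -
  have *: "binary_vecs k \<subseteq> vec k ` (PiE {..<k} (\<lambda>_. {0, 1}))"
  proof
    fix x assume x: "x \<in> binary_vecs k"
    then have "x = vec k (restrict (($) x) {..<k})"
      by (intro eq_vecI) (auto simp: binary_vecs_def)
    moreover have "restrict (($) x) {..<k} \<in> PiE {..<k} (\<lambda>_. {0, 1})"
      using x by (auto simp: binary_vecs_def)
    ultimately show "x \<in> vec k ` (PiE {..<k} (\<lambda>_. {0, 1}))" by blast
  qed
  have fin: "finite (PiE {..<k} (\<lambda>_. {0, 1 :: real}))" by (intro finite_PiE) auto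
  show "finite (binary_vecs k)" using * fin by (auto intro: finite_subset)
  have two: "card {0, 1 :: real} = 2" by simp
  have "card (binary_vecs k) \<le> card (vec k ` (PiE {..<k} (\<lambda>_. {0, 1 :: real})))"
    using * fin by (intro card_mono) auto
  also have "\<dots> \<le> card (PiE {..<k} (\<lambda>_. {0, 1 :: real}))" by (rule card_image_le[OF fin])
  also have "\<dots> = 2 ^ k" by (simp only: card_PiE finite_lessThan two prod_constant card_lessThan)
  finally show "card (binary_vecs k) \<le> 2 ^ k" .
qed

lemma row_binary_mats:
  assumes "U \<in> binary_mats n k" "i < n"
  shows "row U i \<in> binary_vecs k"
proof -
  have "dim_row U = n" "dim_col U = k" using assms by (auto simp: binary_mats_def)
  then show ?thesis using assms by (auto simp: binary_mats_def binary_vecs_def)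
qed

lemma col_binary_mats:
  assumes "V \<in> binary_mats k d" "j < d"
  shows "col V j \<in> binary_vecs k"
proof -
  have "dim_row V = k" "dim_col V = d" using assms by (auto simp: binary_mats_def)
  then show ?thesis using assms by (auto simp: binary_mats_def binary_vecs_def)
qed

definition row_cost :: "(real vec \<Rightarrow> real vec \<Rightarrow> real) \<Rightarrow> real mat \<Rightarrow> real mat \<Rightarrow> nat \<Rightarrow> real vec \<Rightarrow> nat" where
  "row_cost ip A V i x = card {j. j < dim_col V \<and> A $$ (i, j) \<noteq> ip x (col V j)}"

lemma norm0_eq_sum_row_cost:
  assumes "A \<in> carrier_mat n d" "U \<in> carrier_mat n k" "V \<in> carrier_mat k d"
  shows "norm0 (A - gen_prod ip U V) = (\<Sum>i<n. row_cost ip A V i (row U i))"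
proof -
  have "{(i, j). i < dim_row (A - gen_prod ip U V) \<and> j < dim_col (A - gen_prod ip U V) \<and>
      (A - gen_prod ip U V) $$ (i, j) \<noteq> 0}
    = (SIGMA i:{..<n}. {j. j < dim_col V \<and> A $$ (i, j) \<noteq> ip (row U i) (col V j)})"
    using assms by (auto simp: gen_prod_def)
  then show ?thesis by (simp add: norm0_def row_cost_def)
qed

text \<open>Every column of the binary \<open>V\<close> lies in exactly one cluster, on which the
  prediction \<open>ip x y\<close> is constant.\<close>

lemma row_cost_eq_sum_cluster:
  assumes V: "V \<in> binary_mats k d"
  shows "real (row_cost ip A V i x) =
    (\<Sum>y\<in>binary_vecs k. \<Sum>j\<in>cluster V y. of_bool (A $$ (i, j) \<noteq> ip x y))"
proof -
  have d: "dim_col V = d" using V by (auto simp: binary_mats_def)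
  have "real (row_cost ip A V i x) = (\<Sum>j<d. of_bool (A $$ (i, j) \<noteq> ip x (col V j)))"
    by (simp add: row_cost_def d Int_def lessThan_def)
  also have "\<dots> = (\<Sum>y\<in>binary_vecs k. \<Sum>j\<in>{j \<in> {..<d}. col V j = y}. of_bool (A $$ (i, j) \<noteq> ip x (col V j)))"
    by (rule sum.group[symmetric]) (auto simp: finite_binary_vecs intro!: col_binary_mats[OF V])
  also have "\<dots> = (\<Sum>y\<in>binary_vecs k. \<Sum>j\<in>cluster V y. of_bool (A $$ (i, j) \<noteq> ip x y))"
    by (intro sum.cong) (auto simp: cluster_def d)
  finally show ?thesis .
qed

lemma finite_cluster [simp]: "finite (cluster V y)"
  by (simp add: cluster_def)

section \<open>Expected cost of one row\<close>

text \<open>The selection argument with \<open>v = 16 / t\<close>, whence the constant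
  \<open>64 = 4 * 16\<close>. The vector \<open>x0\<close> will be a row of an optimal
  matrix.\<close>

lemma expectation_row_cost_le:
  assumes V: "V \<in> binary_mats k d" and \<epsilon>: "0 < \<epsilon>" "\<epsilon> < 1" and t: "0 < t"
    and \<alpha>: "approx_cluster_sizes (\<epsilon> / 6) V t \<alpha>"
    and sel: "\<And>C. sel C \<in> binary_vecs k"
      "\<And>C. est_cost ip A k C \<alpha> i (sel C) \<le> est_cost ip A k C \<alpha> i x0"
  shows "measure_pmf.expectation (cluster_samples V t) (\<lambda>C. real (row_cost ip A V i (sel C)))
    \<le> (1 + \<epsilon> / 3 + 2 ^ k * (64 / t * (1 + 6 / \<epsilon>))) * real (row_cost ip A V i x0)"
proof -
  let ?Y = "binary_vecs k"
  let ?P = "cluster_samples V t"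
  have dr: "dim_row V = k" using V by (auto simp: binary_mats_def)
  define e where "e x y j = (of_bool (A $$ (i, j) \<noteq> ip x y) :: real)" for x y j
  define E where "E x y = (\<Sum>j\<in>cluster V y. e x y j)" for x y
  define cost where "cost x = real (row_cost ip A V i x)" for x
  define Z where "Z x y j = e x y j - e x0 y j" for x y j
  \<comment> \<open>The mean of the estimated difference: sampling is unbiased, but the weights
    \<open>\<alpha> y\<close> may still overestimate cluster sizes.\<close>
  define m where "m x = (\<Sum>y\<in>?Y. \<alpha> y / real (card (cluster V y)) * (\<Sum>j\<in>cluster V y. Z x y j))" for x
  have E_nonneg: "0 \<le> E x y" for x y by (simp add: E_def e_def sum_nonneg)
  have cost: "cost x = (\<Sum>y\<in>?Y. E x y)" for x
    by (simp only: cost_def row_cost_eq_sum_cluster[OF V] E_def e_def)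
  have E_le: "E x y \<le> cost x" if "y \<in> ?Y" for x y
    unfolding cost using that E_nonneg by (intro member_le_sum) (auto simp: finite_binary_vecs)
  have \<alpha>_bounds: "real (card (cluster V y)) \<le> \<alpha> y"
      "\<alpha> y \<le> (1 + \<epsilon> / 6) * real (card (cluster V y))" if "y \<in> ?Y" for y
  proof -
    have "1 * real (card (cluster V y)) \<le> (1 + \<epsilon> / 6) * real (card (cluster V y))"
      using \<epsilon> by (intro mult_right_mono) auto
    moreover have "if real (card (cluster V y)) < t then \<alpha> y = real (card (cluster V y))
        else real (card (cluster V y)) \<le> \<alpha> y \<and> \<alpha> y \<le> (1 + \<epsilon> / 6) * real (card (cluster V y))"
      using \<alpha> that unfolding approx_cluster_sizes_def dr by blast
    ultimately show "real (card (cluster V y)) \<le> \<alpha> y"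
      "\<alpha> y \<le> (1 + \<epsilon> / 6) * real (card (cluster V y))"
      by (simp_all only: mult_1 split: if_splits)
  qed
  have finP: "finite (set_pmf ?P)"
    unfolding cluster_samples_def dr
    by (intro finite_set_Pi_pmf finite_set_sample_cluster finite_binary_vecs finite_cluster t)
  \<comment> \<open>Each summand is centered and depends only on the sample of its own cluster, so
    the variances add up.\<close>
  have dev: "est_cost ip A k C \<alpha> i x - est_cost ip A k C \<alpha> i x0 - m x =
    (\<Sum>y\<in>?Y. scaled_error (\<alpha> y) (cluster V y) (Z x y) (C y))" for C x
    unfolding est_cost_def m_def scaled_error_def Z_def e_def size_filter_mset_eq_sum
      sum_subtractf[symmetric]
    by (intro sum.cong refl) (simp only: sum_mset_diff_real right_diff_distrib)
  have gap: "cost x - (1 + \<epsilon> / 6) * cost x0 \<le> m x" for x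
  proof -
    have "E x y - (1 + \<epsilon> / 6) * E x0 y \<le>
        \<alpha> y / real (card (cluster V y)) * (\<Sum>j\<in>cluster V y. Z x y j)" if y: "y \<in> ?Y" for y
    proof (cases "cluster V y = {}")
      case False
      define r where "r = \<alpha> y / real (card (cluster V y))"
      have "card (cluster V y) > 0" using False by (simp add: card_gt_0_iff)
      then have r: "1 \<le> r" "r \<le> 1 + \<epsilon> / 6" using \<alpha>_bounds[OF y] by (auto simp: r_def field_simps)
      \<comment> \<open>Overestimation never lowers the error of \<open>x\<close> and inflates that
        of \<open>x0\<close> by at most \<open>1 + \<epsilon> / 6\<close>; this is the slack in
        \<open>gap\<close>.\<close>
      have "1 * E x y \<le> r * E x y" "r * E x0 y \<le> (1 + \<epsilon> / 6) * E x0 y"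
        by (intro mult_right_mono r E_nonneg)+
      then show ?thesis
        by (simp add: Z_def sum_subtractf E_def[symmetric] r_def[symmetric] right_diff_distrib)
    qed (simp add: E_def)
    then show ?thesis
      unfolding cost m_def sum_distrib_left sum_subtractf[symmetric] by (rule sum_mono)
  qed
  have var: "measure_pmf.expectation ?P
      (\<lambda>C. (est_cost ip A k C \<alpha> i x - est_cost ip A k C \<alpha> i x0 - m x)\<^sup>2)
    \<le> 16 / t * cost x0 * (cost x + cost x0)" for x
  proof -
    have "measure_pmf.expectation ?P
        (\<lambda>C. (est_cost ip A k C \<alpha> i x - est_cost ip A k C \<alpha> i x0 - m x)\<^sup>2) =
      (\<Sum>y\<in>?Y. measure_pmf.expectation (sample_cluster t (cluster V y))
        (\<lambda>M. (scaled_error (\<alpha> y) (cluster V y) (Z x y) M)\<^sup>2))"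
      unfolding dev cluster_samples_def dr
      by (intro Pi_pmf_centered_moments[THEN conjunct2] finite_binary_vecs
          finite_set_sample_cluster finite_cluster t scaled_error_moments(1))
    \<comment> \<open>Each cluster is charged its own \<open>E x0 y\<close> times a common factor,
      so that summation yields the factor \<open>cost x0\<close>.\<close>
    also have "\<dots> \<le> (\<Sum>y\<in>?Y. 16 / t * (cost x + cost x0) * E x0 y)"
    proof (rule sum_mono)
      fix y assume y: "y \<in> ?Y"
      let ?n = "real (card (cluster V y))"
      let ?S = "measure_pmf.expectation (sample_cluster t (cluster V y))
        (\<lambda>M. (scaled_error (\<alpha> y) (cluster V y) (Z x y) M)\<^sup>2)"
      note bound = scaled_error_moments(2)[OF finite_cluster[of V y] t, where c = "\<alpha> y" and Z = "Z x y"]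
      show "?S \<le> 16 / t * (cost x + cost x0) * E x0 y"
      proof (cases "ip x y = ip x0 y")
        case True
        have "?S \<le> 0" using bound[where a = 0] True by (simp add: Z_def e_def)
        also have "0 \<le> 16 / t * (cost x + cost x0) * E x0 y"
          using t E_nonneg by (simp add: cost_def)
        finally show ?thesis .
      next
        case False
        \<comment> \<open>Centering at \<open>1\<close> keeps the bound proportional to the error of \<open>x0\<close>: if \<open>x\<close> is correct at \<open>j\<close>,
          then \<open>x0\<close> is wrong there.\<close>
        have "(\<Sum>j\<in>cluster V y. (Z x y j - 1)\<^sup>2) \<le> (\<Sum>j\<in>cluster V y. 4 * e x0 y j)"
          using False by (intro sum_mono) (auto simp: Z_def e_def)
        then have S: "(\<Sum>j\<in>cluster V y. (Z x y j - 1)\<^sup>2) \<le> 4 * E x0 y"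
          by (simp add: E_def sum_distrib_left)
        \<comment> \<open>The predictions differ, so at every column at least one is wrong; the two
          costs therefore pay for the cluster size.\<close>
        have "?n = (\<Sum>j\<in>cluster V y. 1)" by simp
        also have "\<dots> \<le> (\<Sum>j\<in>cluster V y. e x y j + e x0 y j)"
          using False by (intro sum_mono) (auto simp: e_def)
        also have "\<dots> = E x y + E x0 y" by (simp add: E_def sum.distrib)
        also have "\<dots> \<le> cost x + cost x0" using E_le[OF y] by (intro add_mono) auto
        finally have n: "?n \<le> cost x + cost x0" .
        have "(1 + \<epsilon> / 6) * ?n \<le> 2 * ?n" using \<epsilon> by (intro mult_right_mono) auto
        then have "\<alpha> y \<le> 2 * ?n" using \<alpha>_bounds(2)[OF y] by linarith
        then have "(\<alpha> y)\<^sup>2 \<le> (2 * ?n)\<^sup>2"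
          using \<alpha>_bounds(1)[OF y] by (intro power_mono) (meson of_nat_0_le_iff order_trans)+
        \<comment> \<open>The constant \<open>16\<close> arises as \<open>2 ^ 2\<close> from the
          bound on \<open>\<alpha> y\<close> times \<open>4\<close> from \<open>S\<close>.\<close>
        then have "?S \<le> (2 * ?n)\<^sup>2 / t * (4 * E x0 y / ?n)"
          using t S by (intro order.trans[OF bound[where a = 1]] mult_mono divide_right_mono)
            (auto intro!: divide_nonneg_nonneg sum_nonneg)
        also have "\<dots> = 16 / t * ?n * E x0 y" by (simp add: power2_eq_square)
        also have "\<dots> \<le> 16 / t * (cost x + cost x0) * E x0 y"
          using n t E_nonneg by (intro mult_right_mono mult_left_mono) auto
        finally show ?thesis .
      qed
    qed
    also have "\<dots> = 16 / t * cost x0 * (cost x + cost x0)"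
      unfolding sum_distrib_left[symmetric] cost[symmetric] by (simp only: mult_ac)
    finally show ?thesis .
  qed
  have "measure_pmf.expectation ?P (\<lambda>C. cost (sel C))
    \<le> (1 + \<epsilon> / 3 + real (card ?Y) * (4 * (16 / t) * (1 + 6 / \<epsilon>))) * cost x0"
  proof (rule expectation_cost_minimizer_le[where est = "\<lambda>C. est_cost ip A k C \<alpha> i" and m = m])
    show "0 \<le> cost x0" by (simp add: cost_def)
    show "0 \<le> 16 / t" using t by simp
  qed (rule finP finite_binary_vecs sel \<epsilon> gap var)+
  also have "\<dots> \<le> (1 + \<epsilon> / 3 + 2 ^ k * (64 / t * (1 + 6 / \<epsilon>))) * cost x0"
  proof (intro mult_right_mono add_left_mono mult_mono)
    show "real (card ?Y) \<le> 2 ^ k"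
      using card_binary_vecs_le[of k] by (metis of_nat_le_iff of_nat_numeral of_nat_power)
  qed (use t \<epsilon> in \<open>auto simp: cost_def\<close>)
  finally show ?thesis by (simp only: cost_def)
qed

section \<open>Optimal matrix, constants and summation over rows\<close>

lemma opt_cost_attained:
  assumes A: "A \<in> carrier_mat n d" and V: "V \<in> carrier_mat k d"
  obtains U where "U \<in> binary_mats n k" "opt_cost ip A V = norm0 (A - gen_prod ip U V)"
proof -
  let ?f = "\<lambda>U. norm0 (A - gen_prod ip U V)"
  have dims: "dim_row A = n" "dim_row V = k" "dim_col V = d" using A V by auto
  \<comment> \<open>Bounded natural numbers form a finite image, so the minimum is attained without
    counting matrices.\<close>
  have "?f U \<le> n * d" if "U \<in> binary_mats n k" for U
  proof -
    have "U \<in> carrier_mat n k" using that by (simp add: binary_mats_def)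
    then have "?f U \<le> card ({..<n} \<times> {..<d})"
      unfolding norm0_def using A V by (intro card_mono) (auto simp: gen_prod_def)
    then show ?thesis by simp
  qed
  then have "?f ` binary_mats n k \<subseteq> {..n * d}" by blast
  then have fin: "finite (?f ` binary_mats n k)" by (rule finite_subset) simp
  have "0\<^sub>m n k \<in> binary_mats n k" by (auto simp: binary_mats_def)
  then have "Min (?f ` binary_mats n k) \<in> ?f ` binary_mats n k" using fin by (intro Min_in) auto
  then show ?thesis using that unfolding opt_cost_def dims by auto
qed

text \<open>The threshold for bad candidates spends a third of the budget \<open>\<epsilon>\<close>;
  the union bound over at most \<open>2 ^ k\<close> candidates must fit into the other two
  thirds.\<close>

lemma sample_size_suffices:
  fixes \<epsilon> :: real
  assumes \<epsilon>: "0 < \<epsilon>" "\<epsilon> < 1" and t_def: "t = 2 ^ (4 * k + 14) / \<epsilon>\<^sup>2"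
  shows "2 ^ k * (64 / t * (1 + 6 / \<epsilon>)) \<le> 2 / 3 * \<epsilon>"
proof -
  have t: "0 < t" using \<epsilon> by (simp add: t_def)
  define p where "p = (2::real) ^ k"
  have p: "1 \<le> p" by (simp add: p_def)
  have "(2::real) ^ (4 * k + 14) = p ^ 4 * 16384"
    by (simp add: p_def power_add power_mult[symmetric] mult.commute)
  then have t_eq: "t = p ^ 4 * 16384 / \<epsilon>\<^sup>2" by (simp add: t_def)
  have "1 + 6 / \<epsilon> \<le> 7 / \<epsilon>" using \<epsilon> by (simp add: field_simps)
  then have "p * (64 / t * (1 + 6 / \<epsilon>)) \<le> p * (64 / t * (7 / \<epsilon>))"
    using t p by (intro mult_left_mono) auto
  \<comment> \<open>Here \<open>64 * 7 / 16384 = 7 / 256\<close>, and \<open>p ^ 4\<close> in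
    \<open>t\<close> outweighs the \<open>p\<close> of the union bound.\<close>
  also have "\<dots> = \<epsilon> * (7 / 256) * (1 / p ^ 3)"
    using \<epsilon> p by (simp add: t_eq power2_eq_square power3_eq_cube power4_eq_xxxx)
  also have "\<dots> \<le> \<epsilon> * (7 / 256) * 1"
    using \<epsilon> p one_le_power[OF p, of 3] by (intro mult_left_mono) auto
  finally show ?thesis using \<epsilon> by (simp add: p_def)
qed

theorem theorem4p1:
  fixes n d k :: nat
    and ip :: "real vec \<Rightarrow> real vec \<Rightarrow> real"
    and A V :: "real mat"
    and \<epsilon> t :: real
    and \<alpha> :: "real vec \<Rightarrow> real"
    and Ut :: "(real vec \<Rightarrow> nat multiset) \<Rightarrow> (real vec \<Rightarrow> real) \<Rightarrow> real mat"
  assumes "A \<in> binary_mats n d"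
    and "k > 0"
    and "0 < \<epsilon>" and "\<epsilon> < 1"
    and "V \<in> binary_mats k d"
    and "t = 2 ^ (4 * k + 14) / \<epsilon>\<^sup>2"
    and "approx_cluster_sizes (\<epsilon> / 6) V t \<alpha>"
    and "\<And>C. is_est_minimizer ip A k C \<alpha> (Ut C \<alpha>)"
  shows "measure_pmf.expectation (cluster_samples V t)
           (\<lambda>C. real (norm0 (A - gen_prod ip (Ut C \<alpha>) V)))
         \<le> (1 + \<epsilon>) * real (opt_cost ip A V)"
proof -
  note \<epsilon> = assms(3,4) and V = assms(5) and t_def = assms(6)
  let ?P = "cluster_samples V t"
  have Ac: "A \<in> carrier_mat n d" and Vc: "V \<in> carrier_mat k d"
    using assms(1) V by (auto simp: binary_mats_def)
  have t: "0 < t" using \<epsilon> by (simp add: t_def)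
  have dims: "dim_row A = n" "dim_row V = k" using Ac Vc by auto
  obtain U where U: "U \<in> binary_mats n k" "opt_cost ip A V = norm0 (A - gen_prod ip U V)"
    using opt_cost_attained[OF Ac Vc] .
  have Ut: "Ut C \<alpha> \<in> binary_mats n k" for C
    using assms(8)[of C] by (simp add: is_est_minimizer_def dims)
  have Uc: "U \<in> carrier_mat n k" "Ut C \<alpha> \<in> carrier_mat n k" for C
    using U(1) Ut[of C] by (auto simp: binary_mats_def)
  have finP: "finite (set_pmf ?P)"
    unfolding cluster_samples_def
    by (intro finite_set_Pi_pmf finite_set_sample_cluster finite_binary_vecs finite_cluster t)
  define K where "K = 1 + \<epsilon> / 3 + 2 ^ k * (64 / t * (1 + 6 / \<epsilon>))"
  \<comment> \<open>One sample serves all rows; their dependence is harmless since only linearity of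
    expectation combines them.\<close>
  have row: "measure_pmf.expectation ?P (\<lambda>C. real (row_cost ip A V i (row (Ut C \<alpha>) i)))
      \<le> K * real (row_cost ip A V i (row U i))" if i: "i < n" for i
    unfolding K_def
  proof (rule expectation_row_cost_le[OF V \<epsilon> t assms(7)])
    fix C
    show "row (Ut C \<alpha>) i \<in> binary_vecs k" by (rule row_binary_mats[OF Ut i])
    show "est_cost ip A k C \<alpha> i (row (Ut C \<alpha>) i) \<le> est_cost ip A k C \<alpha> i (row U i)"
      using assms(8)[of C] i unfolding is_est_minimizer_def is_arg_min_linorder dims
      using row_binary_mats[OF U(1) i] by blast
  qed
  have "K \<le> 1 + \<epsilon>"
    using sample_size_suffices[OF \<epsilon> t_def] unfolding K_def by linarith
  have "measure_pmf.expectation ?P (\<lambda>C. real (norm0 (A - gen_prod ip (Ut C \<alpha>) V))) =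
    (\<Sum>i<n. measure_pmf.expectation ?P (\<lambda>C. real (row_cost ip A V i (row (Ut C \<alpha>) i))))"
    unfolding norm0_eq_sum_row_cost[OF Ac Uc(2) Vc] of_nat_sum
    by (rule Bochner_Integration.integral_sum) (rule integrable_measure_pmf_finite[OF finP])
  also have "\<dots> \<le> (\<Sum>i<n. K * real (row_cost ip A V i (row U i)))"
    using row by (intro sum_mono) auto
  also have "\<dots> = K * real (opt_cost ip A V)"
    unfolding U(2) norm0_eq_sum_row_cost[OF Ac Uc(1) Vc] of_nat_sum by (rule sum_distrib_left[symmetric])
  also have "\<dots> \<le> (1 + \<epsilon>) * real (opt_cost ip A V)"
    using \<open>K \<le> 1 + \<epsilon>\<close> by (intro mult_right_mono) auto
  finally show ?thesis .
qed

end
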